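(* Let $\mathbf{L}$ be a representable distributive quasi relation algebra. Then the nested sum $\mathbf{S}_3[\mathbf{L}]$ is a representable distributive quasi relation algebra. Moreover, if $\mathbf{L}$ is finitely representable, then $\mathbf{S}_3[\mathbf{L}]$ is finitely representable.
   Context: A residuated lattice is an algebra $\langle A,\wedge,\vee,\cdot,\backslash,/,1\rangle$ such that $\langle A,\wedge,\vee\rangle$ is a lattice, $\langle A,\cdot,1\rangle$ is a monoid, and for all $a,b,c\in A$: $a\cdot b\leqslant c \iff a\leqslant c/b\iff b\leqslant a\backslash c$. An InFL-algebra is an algebra $\langle A,\wedge,\vee,\cdot,{\sim},-,1,0\rangle$ with $0=-1={\sim}1$, where $\langle A,\wedge,\vee\rangle$ is a lattice, $\langle A,\cdot,1\rangle$ is a monoid and $a\cdot b\leqslant c\iff a\leqslant -(b\cdot{\sim}c)\iff b\leqslant {\sim}(-c\cdot a)$; it is a residuated lattice with $c/b=-(b\cdot{\sim}c)$, $a\backslash c={\sim}(-c\cdot a)$, and ${\sim}a=a\backslash 0$, $-a=0/a$, ${\sim}{-}a=a={-}{\sim}a$. Put $a+b={\sim}(-a\cdot -b)$. A quasi relation algebra (qRA) is an algebra $\langle A,\wedge,\vee,\cdot,{\sim},-,\neg,1,0\rangle$ whose $\neg$-free reduct is an InFL-algebra and which satisfies $\neg\neg a=a$, $\neg(a\vee b)=\neg a\wedge\neg b$, $\neg({\sim}a)=-(\neg a)$ and $\neg(a\cdot b)=\neg a+\neg b$. A distributive quasi relation algebra (DqRA) is a qRA whose lattice reduct is distributive. $\mathbf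 S_3$ is the three-element Sugihara chain, viewed as a DqRA: $S_3=\{a_{-1},a_0,a_1\}$ with $a_{-1}<a_0<a_1$, ${\sim}a_j=-a_j=\neg a_j=a_{-j}$, $1=0=a_0$, and $a_i\cdot a_j=a_i$ if $|j|<|i|$, $a_j$ if $|i|<|j|$, $a_{\min\{i,j\}}$ if $|i|=|j|$. Nested sum: let $\mathbf K,\mathbf L$ be qRAs with $K\cap L=\varnothing$ and $1_{\mathbf K}$ totally irreducible (i.e. for every non-nullary operation $f$ of $\mathbf K$, $f(b_1,\dots,b_n)=1_{\mathbf K}$ implies $b_i=1_{\mathbf K}$ for some $i$; this holds for $\mathbf K=\mathbf S_3$). The universe of $\mathbf K[\mathbf L]$ is $K[L]=(K\setminus\{1_{\mathbf K}\})\cup L$, with $1_{\mathbf K[\mathbf L]}=1_{\mathbf L}$, $0_{\mathbf K[\mathbf L]}=0_{\mathbf L}$. For $\star\in\{\cdot,\backslash,/\}$, $m_0\star_{\mathbf K[\mathbf L]}m_1$ equals: $m_0\star_{\mathbf K}m_1$ if $m_0,m_1\in K\setminus\{1_{\mathbf K}\}$; $m_0\star_{\mathbf L}m_1$ if $m_0,m_1\in L$; $m_0\star_{\mathbf K}1_{\mathbf K}$ if $m_0\in K\setminus\{1_{\mathbf K}\}$, $m_1\in L$; $1_{\mathbf K}\star_{\mathbf K}m_1$ if $m_0\in L$, $m_1\in K\setminus\{1_{\mathbf K}\}$. The operations $\wedge_{\mathbf K[\mathbf L]}$, $\vee_{\mathbf K[\mathbf L]}$ are commutative, agree with those of $\mathbf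 K$ on $K\setminus\{1_{\mathbf K}\}$ and with those of $\mathbf L$ on $L$, and for $k\in K\setminus\{1_{\mathbf K}\}$, $\ell\in L$: $k\wedge\ell=\ell$ if $k\geqslant_{\mathbf K}1_{\mathbf K}$ and $k\wedge\ell=k\wedge_{\mathbf K}1_{\mathbf K}$ otherwise; $k\vee\ell=\ell$ if $k\leqslant_{\mathbf K}1_{\mathbf K}$ and $k\vee\ell=k\vee_{\mathbf K}1_{\mathbf K}$ otherwise. The linear negations are ${\sim}_{\mathbf K[\mathbf L]}m=m\backslash_{\mathbf K[\mathbf L]}0_{\mathbf K[\mathbf L]}$ and $-_{\mathbf K[\mathbf L]}m=0_{\mathbf K[\mathbf L]}/_{\mathbf K[\mathbf L]}m$, and $\neg_{\mathbf K[\mathbf L]}m$ is $\neg_{\mathbf L}m$ for $m\in L$ and $\neg_{\mathbf K}m$ for $m\in K\setminus\{1_{\mathbf K}\}$. Representability: for binary relations, $R^\smile=\{(x,y)\mid (y,x)\in R\}$ and $R\mathbin{;}S=\{(x,y)\mid \exists z\,((x,z)\in R,\ (z,y)\in S)\}$; functions are identified with their graphs. Let $(X,\leqslant)$ be a poset, $E$ an equivalence relation on $X$ with ${\leqslant}\subseteq E$, and write $R^c=E\setminus R$ for $R\subseteq E$. Order $E$ by $(u,v)\preccurlyeq(x,y)$ iff $x\leqslant u$ and $v\leqslant y$; let $\mathbf E=(E,\preccurlyeq)$ and let $\mathsf{Up}(\mathbf E)$ be the set of its up-sets. Let $\alpha:X\to X$ be an order automorphism and $\beta:X\to X$ a self-inverse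 dual order automorphism with $\alpha,\beta\subseteq E$ and $\beta=\alpha\mathbin{;}\beta\mathbin{;}\alpha$. Then $\mathbf{Dq}(\mathbf E)=\langle\mathsf{Up}(\mathbf E),\cap,\cup,\mathbin{;},{\sim},-,\neg,1,0\rangle$ with $1={\leqslant}$, $0=\alpha\mathbin{;}({\leqslant}^c)^{\smile}$, ${\sim}R=(R^{c})^{\smile}\mathbin{;}\alpha$, $-R=\alpha\mathbin{;}(R^{c})^{\smile}$, $\neg R=\alpha\mathbin{;}\beta\mathbin{;}R^c\mathbin{;}\beta$ is a DqRA (it depends on $\alpha,\beta$). A DqRA is representable if it is isomorphic to a subalgebra of some $\mathbf{Dq}(\mathbf E)$ (equivalently, to a subalgebra of a product of algebras $\mathbf{Dq}(\mathbf E)$ with $E=X^2$). It is finitely representable if the poset $(X,\leqslant)$ used in the representation can be taken finite.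
   Formalization: In the definition of a quasi relation algebra, a + b is taken as ∼(−b·−a) instead of the printed ∼(−a·−b); with the printed order the algebras Dq(E) with non-commutative composition would not be DqRAs. *)

theory Defs
  imports "HOL-Algebra.Group"
begin

section \<open>Distributive quasi relation algebras\<close>

text \<open>
  The signature extends the monoids of HOL-Algebra. The field \<open>tilde\<close> is the linear negation
  \<open>\<sim>\<close>, \<open>dash\<close> is the linear negation \<open>-\<close>, and \<open>neg\<close> is the involution \<open>\<not>\<close>.
\<close>

record 'a qra = "'a monoid" +
  wedge :: "'a \<Rightarrow> 'a \<Rightarrow> 'a"
  vee :: "'a \<Rightarrow> 'a \<Rightarrow> 'a"
  tilde :: "'a \<Rightarrow> 'a"
  dash :: "'a \<Rightarrow> 'a"
  neg :: "'a \<Rightarrow> 'a"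
  zero :: 'a

definition leq :: "('a, 'b) qra_scheme \<Rightarrow> 'a \<Rightarrow> 'a \<Rightarrow> bool" where
  "leq A x y \<longleftrightarrow> wedge A x y = x"

definition under :: "('a, 'b) qra_scheme \<Rightarrow> 'a \<Rightarrow> 'a \<Rightarrow> 'a" where
  "under A x z = tilde A (dash A z \<otimes>\<^bsub>A\<^esub> x)"  \<comment> \<open>\<open>x \ z\<close>\<close>

definition over :: "('a, 'b) qra_scheme \<Rightarrow> 'a \<Rightarrow> 'a \<Rightarrow> 'a" where
  "over A z y = dash A (y \<otimes>\<^bsub>A\<^esub> tilde A z)"  \<comment> \<open>\<open>z / y\<close>\<close>

text \<open>
  The factors \<open>-y\<close> and \<open>-x\<close> have to occur in this order: for \<open>R, S\<close> in an algebra \<open>Dq\<close> as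
  defined below, the complement of \<open>R ; S\<close> is the relational sum of the complements of \<open>R\<close> and \<open>S\<close>
  in the same order, and linear negation reverses the order of composition. With \<open>-x\<close> and
  \<open>-y\<close> exchanged, no algebra \<open>Dq\<close> with non-commutative composition would satisfy
  \<open>\<not>(x \<cdot> y) = \<not>x + \<not>y\<close>. If multiplication is commutative the order is immaterial.
\<close>

definition dual_plus :: "('a, 'b) qra_scheme \<Rightarrow> 'a \<Rightarrow> 'a \<Rightarrow> 'a" where
  "dual_plus A x y = tilde A (dash A y \<otimes>\<^bsub>A\<^esub> dash A x)"

locale lattice_reduct =
  fixes A :: "('a, 'b) qra_scheme" (structure)
  assumes wedge_closed: "\<lbrakk>x \<in> carrier A; y \<in> carrier A\<rbrakk> \<Longrightarrow> wedge A x y \<in> carrier A"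
    and vee_closed: "\<lbrakk>x \<in> carrier A; y \<in> carrier A\<rbrakk> \<Longrightarrow> vee A x y \<in> carrier A"
    and wedge_comm: "\<lbrakk>x \<in> carrier A; y \<in> carrier A\<rbrakk> \<Longrightarrow> wedge A x y = wedge A y x"
    and vee_comm: "\<lbrakk>x \<in> carrier A; y \<in> carrier A\<rbrakk> \<Longrightarrow> vee A x y = vee A y x"
    and wedge_assoc: "\<lbrakk>x \<in> carrier A; y \<in> carrier A; z \<in> carrier A\<rbrakk>
          \<Longrightarrow> wedge A (wedge A x y) z = wedge A x (wedge A y z)"
    and vee_assoc: "\<lbrakk>x \<in> carrier A; y \<in> carrier A; z \<in> carrier A\<rbrakk>
          \<Longrightarrow> vee A (vee A x y) z = vee A x (vee A y z)"
    and wedge_absorb: "\<lbrakk>x \<in> carrier A; y \<in> carrier A\<rbrakk> \<Longrightarrow> wedge A x (vee A x y) = x"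
    and vee_absorb: "\<lbrakk>x \<in> carrier A; y \<in> carrier A\<rbrakk> \<Longrightarrow> vee A x (wedge A x y) = x"

locale infl_algebra = lattice_reduct A + monoid A
  for A :: "('a, 'b) qra_scheme" (structure) +
  assumes tilde_closed: "x \<in> carrier A \<Longrightarrow> tilde A x \<in> carrier A"
    and dash_closed: "x \<in> carrier A \<Longrightarrow> dash A x \<in> carrier A"
    and zero_closed: "zero A \<in> carrier A"
    and zero_dash: "zero A = dash A \<one>"
    and zero_tilde: "zero A = tilde A \<one>"
    and resid_over: "\<lbrakk>a \<in> carrier A; b \<in> carrier A; c \<in> carrier A\<rbrakk>
          \<Longrightarrow> leq A (a \<otimes> b) c \<longleftrightarrow> leq A a (over A c b)"
    and resid_under: "\<lbrakk>a \<in> carrier A; b \<in> carrier A; c \<in> carrier A\<rbrakk>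
          \<Longrightarrow> leq A (a \<otimes> b) c \<longleftrightarrow> leq A b (under A a c)"

locale quasi_relation_algebra = infl_algebra A
  for A :: "('a, 'b) qra_scheme" (structure) +
  assumes neg_closed: "x \<in> carrier A \<Longrightarrow> neg A x \<in> carrier A"
    and neg_neg: "x \<in> carrier A \<Longrightarrow> neg A (neg A x) = x"
    and neg_vee: "\<lbrakk>x \<in> carrier A; y \<in> carrier A\<rbrakk>
          \<Longrightarrow> neg A (vee A x y) = wedge A (neg A x) (neg A y)"
    and neg_tilde: "x \<in> carrier A \<Longrightarrow> neg A (tilde A x) = dash A (neg A x)"
    and neg_mult: "\<lbrakk>x \<in> carrier A; y \<in> carrier A\<rbrakk>
          \<Longrightarrow> neg A (x \<otimes> y) = dual_plus A (neg A x) (neg A y)"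

locale dqra = quasi_relation_algebra A
  for A :: "('a, 'b) qra_scheme" (structure) +
  assumes wedge_vee_distrib: "\<lbrakk>x \<in> carrier A; y \<in> carrier A; z \<in> carrier A\<rbrakk>
          \<Longrightarrow> wedge A x (vee A y z) = vee A (wedge A x y) (wedge A x z)"


section \<open>Subalgebras and isomorphisms\<close>

definition qra_subalgebra :: "'a set \<Rightarrow> ('a, 'b) qra_scheme \<Rightarrow> bool" where
  "qra_subalgebra S A \<longleftrightarrow> S \<subseteq> carrier A \<and> \<one>\<^bsub>A\<^esub> \<in> S \<and> zero A \<in> S
    \<and> (\<forall>x\<in>S. tilde A x \<in> S \<and> dash A x \<in> S \<and> neg A x \<in> S)
    \<and> (\<forall>x\<in>S. \<forall>y\<in>S. wedge A x y \<in> S \<and> vee A x y \<in> S \<and> x \<otimes>\<^bsub>A\<^esub> y \<in> S)"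

definition qra_iso :: "('a, 'c) qra_scheme \<Rightarrow> ('b, 'd) qra_scheme \<Rightarrow> ('a \<Rightarrow> 'b) set" where
  "qra_iso A B = {h. bij_betw h (carrier A) (carrier B)
    \<and> h \<one>\<^bsub>A\<^esub> = \<one>\<^bsub>B\<^esub> \<and> h (zero A) = zero B
    \<and> (\<forall>x\<in>carrier A. h (tilde A x) = tilde B (h x) \<and> h (dash A x) = dash B (h x)
          \<and> h (neg A x) = neg B (h x))
    \<and> (\<forall>x\<in>carrier A. \<forall>y\<in>carrier A. h (wedge A x y) = wedge B (h x) (h y)
          \<and> h (vee A x y) = vee B (h x) (h y) \<and> h (x \<otimes>\<^bsub>A\<^esub> y) = h x \<otimes>\<^bsub>B\<^esub> h y)}"

definition qra_isomorphic :: "('a, 'c) qra_scheme \<Rightarrow> ('b, 'd) qra_scheme \<Rightarrow> bool" where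
  "qra_isomorphic A B \<longleftrightarrow> qra_iso A B \<noteq> {}"


section \<open>Representability\<close>

definition fun_graph :: "'x set \<Rightarrow> ('x \<Rightarrow> 'x) \<Rightarrow> 'x rel" where
  "fun_graph X f = {(x, f x) | x. x \<in> X}"

locale dq_frame =
  fixes X :: "'x set" and leX E :: "'x rel" and \<alpha> \<beta> :: "'x \<Rightarrow> 'x"
  assumes poset: "partial_order_on X leX"
    and equiv: "equiv X E"
    and leX_E: "leX \<subseteq> E"
    and \<alpha>_bij: "bij_betw \<alpha> X X"
    and \<alpha>_order: "\<lbrakk>x \<in> X; y \<in> X\<rbrakk> \<Longrightarrow> (\<alpha> x, \<alpha> y) \<in> leX \<longleftrightarrow> (x, y) \<in> leX"
    and \<beta>_bij: "bij_betw \<beta> X X"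
    and \<beta>_order: "\<lbrakk>x \<in> X; y \<in> X\<rbrakk> \<Longrightarrow> (\<beta> x, \<beta> y) \<in> leX \<longleftrightarrow> (y, x) \<in> leX"
    and \<beta>_self_inverse: "x \<in> X \<Longrightarrow> \<beta> (\<beta> x) = x"
    and \<alpha>_E: "fun_graph X \<alpha> \<subseteq> E"
    and \<beta>_E: "fun_graph X \<beta> \<subseteq> E"
    and \<beta>_\<alpha>: "fun_graph X \<beta> = fun_graph X \<alpha> O fun_graph X \<beta> O fun_graph X \<alpha>"

text \<open>The up-sets of \<open>E\<close> with respect to \<open>(u, v) \<preceq> (x, y)\<close> iff \<open>x \<le> u\<close> and \<open>v \<le> y\<close>.\<close>

definition Up :: "'x rel \<Rightarrow> 'x rel \<Rightarrow> 'x rel set" where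
  "Up leX E = {R. R \<subseteq> E \<and>
    (\<forall>u v x y. (u, v) \<in> R \<and> (x, y) \<in> E \<and> (x, u) \<in> leX \<and> (v, y) \<in> leX \<longrightarrow> (x, y) \<in> R)}"

definition Dq :: "'x set \<Rightarrow> 'x rel \<Rightarrow> 'x rel \<Rightarrow> ('x \<Rightarrow> 'x) \<Rightarrow> ('x \<Rightarrow> 'x) \<Rightarrow> 'x rel qra" where
  "Dq X leX E \<alpha> \<beta> =
    \<lparr> carrier = Up leX E,
      mult = (O),
      one = leX,
      wedge = (\<inter>),
      vee = (\<union>),
      tilde = (\<lambda>R. (E - R)\<inverse> O fun_graph X \<alpha>),
      dash = (\<lambda>R. fun_graph X \<alpha> O (E - R)\<inverse>),
      neg = (\<lambda>R. fun_graph X \<alpha> O fun_graph X \<beta> O (E - R) O fun_graph X \<beta>),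
      zero = fun_graph X \<alpha> O (E - leX)\<inverse> \<rparr>"

definition represented_on :: "'x set \<Rightarrow> ('a, 'b) qra_scheme \<Rightarrow> bool" where
  "represented_on X A \<longleftrightarrow> (\<exists>leX E \<alpha> \<beta> S. dq_frame X leX E \<alpha> \<beta>
    \<and> qra_subalgebra S (Dq X leX E \<alpha> \<beta>)
    \<and> qra_isomorphic A (Dq X leX E \<alpha> \<beta> \<lparr>carrier := S\<rparr>))"

text \<open>
  HOL cannot quantify over types inside a formula, so the type \<open>'x\<close> of which the underlying set
  of the poset is a subset is a parameter. Since \<open>X\<close> is an arbitrary subset, representability
  over \<open>'x\<close> implies representability over every type into which \<open>'x\<close> embeds, and \<open>A\<close> is
  representable if and only if it is representable over some type \<open>'x\<close>.
\<close>

definition representable :: "'x itself \<Rightarrow> ('a, 'b) qra_scheme \<Rightarrow> bool" where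
  "representable TYPE('x) A \<longleftrightarrow> dqra A \<and> (\<exists>X :: 'x set. represented_on X A)"

definition finitely_representable :: "'x itself \<Rightarrow> ('a, 'b) qra_scheme \<Rightarrow> bool" where
  "finitely_representable TYPE('x) A \<longleftrightarrow>
    dqra A \<and> (\<exists>X :: 'x set. finite X \<and> represented_on X A)"


section \<open>Nested sums\<close>

text \<open>
  The disjoint universes of \<open>K\<close> and \<open>L\<close> are the two summands of a sum type. The functions below
  are only meaningful if \<open>\<one>\<^bsub>K\<^esub>\<close> is totally irreducible, since otherwise the \<open>K\<close>-part need
  not stay inside \<open>carrier K - {\<one>\<^bsub>K\<^esub>}\<close>.
\<close>

definition totally_irreducible :: "('a, 'b) qra_scheme \<Rightarrow> 'a \<Rightarrow> bool" where
  "totally_irreducible K e \<longleftrightarrow>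
    (\<forall>x\<in>carrier K. (tilde K x = e \<longrightarrow> x = e) \<and> (dash K x = e \<longrightarrow> x = e) \<and> (neg K x = e \<longrightarrow> x = e))
    \<and> (\<forall>x\<in>carrier K. \<forall>y\<in>carrier K. (wedge K x y = e \<longrightarrow> x = e \<or> y = e)
          \<and> (vee K x y = e \<longrightarrow> x = e \<or> y = e) \<and> (x \<otimes>\<^bsub>K\<^esub> y = e \<longrightarrow> x = e \<or> y = e))"

text \<open>The common shape of the product and the two residuals; here \<open>e\<close> is \<open>\<one>\<^bsub>K\<^esub>\<close>.\<close>

fun nested_op :: "'k \<Rightarrow> ('k \<Rightarrow> 'k \<Rightarrow> 'k) \<Rightarrow> ('l \<Rightarrow> 'l \<Rightarrow> 'l) \<Rightarrow> 'k + 'l \<Rightarrow> 'k + 'l \<Rightarrow> 'k + 'l" where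
  "nested_op e f g (Inl k) (Inl k') = Inl (f k k')"
| "nested_op e f g (Inr l) (Inr l') = Inr (g l l')"
| "nested_op e f g (Inl k) (Inr l) = Inl (f k e)"
| "nested_op e f g (Inr l) (Inl k) = Inl (f e k)"

fun nested_wedge :: "('k, 'c) qra_scheme \<Rightarrow> ('l, 'd) qra_scheme \<Rightarrow> 'k + 'l \<Rightarrow> 'k + 'l \<Rightarrow> 'k + 'l" where
  "nested_wedge K L (Inl k) (Inl k') = Inl (wedge K k k')"
| "nested_wedge K L (Inr l) (Inr l') = Inr (wedge L l l')"
| "nested_wedge K L (Inl k) (Inr l) = (if leq K \<one>\<^bsub>K\<^esub> k then Inr l else Inl (wedge K k \<one>\<^bsub>K\<^esub>))"
| "nested_wedge K L (Inr l) (Inl k) = (if leq K \<one>\<^bsub>K\<^esub> k then Inr l else Inl (wedge K k \<one>\<^bsub>K\<^esub>))"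

fun nested_vee :: "('k, 'c) qra_scheme \<Rightarrow> ('l, 'd) qra_scheme \<Rightarrow> 'k + 'l \<Rightarrow> 'k + 'l \<Rightarrow> 'k + 'l" where
  "nested_vee K L (Inl k) (Inl k') = Inl (vee K k k')"
| "nested_vee K L (Inr l) (Inr l') = Inr (vee L l l')"
| "nested_vee K L (Inl k) (Inr l) = (if leq K k \<one>\<^bsub>K\<^esub> then Inr l else Inl (vee K k \<one>\<^bsub>K\<^esub>))"
| "nested_vee K L (Inr l) (Inl k) = (if leq K k \<one>\<^bsub>K\<^esub> then Inr l else Inl (vee K k \<one>\<^bsub>K\<^esub>))"

definition nested_under ::
  "('k, 'c) qra_scheme \<Rightarrow> ('l, 'd) qra_scheme \<Rightarrow> 'k + 'l \<Rightarrow> 'k + 'l \<Rightarrow> 'k + 'l" where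
  "nested_under K L = nested_op \<one>\<^bsub>K\<^esub> (under K) (under L)"

definition nested_over ::
  "('k, 'c) qra_scheme \<Rightarrow> ('l, 'd) qra_scheme \<Rightarrow> 'k + 'l \<Rightarrow> 'k + 'l \<Rightarrow> 'k + 'l" where
  "nested_over K L = nested_op \<one>\<^bsub>K\<^esub> (over K) (over L)"

definition nested_sum :: "('k, 'c) qra_scheme \<Rightarrow> ('l, 'd) qra_scheme \<Rightarrow> ('k + 'l) qra" where
  "nested_sum K L =
    \<lparr> carrier = (carrier K - {\<one>\<^bsub>K\<^esub>}) <+> carrier L,
      mult = nested_op \<one>\<^bsub>K\<^esub> (mult K) (mult L),
      one = Inr \<one>\<^bsub>L\<^esub>,
      wedge = nested_wedge K L,
      vee = nested_vee K L,
      tilde = (\<lambda>m. nested_under K L m (Inr (zero L))),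
      dash = (\<lambda>m. nested_over K L (Inr (zero L)) m),
      neg = map_sum (neg K) (neg L),
      zero = Inr (zero L) \<rparr>"


section \<open>The three-element Sugihara chain\<close>

text \<open>The element \<open>a\<^sub>j\<close> is represented by the integer \<open>j\<close>.\<close>

definition S3 :: "int qra" where
  "S3 =
    \<lparr> carrier = {-1, 0, 1},
      mult = (\<lambda>i j. if \<bar>j\<bar> < \<bar>i\<bar> then i else if \<bar>i\<bar> < \<bar>j\<bar> then j else min i j),
      one = 0,
      wedge = min,
      vee = max,
      tilde = uminus,
      dash = uminus,
      neg = uminus,
      zero = 0 \<rparr>"

lemma dqra_S3: "dqra S3"
  by unfold_locales (simp_all only: S3_def leq_def under_def over_def dual_plus_def qra.simps monoid.simps partial_object.simps insert_iff empty_iff simp_thms, (elim disjE; simp)+)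

lemma totally_irreducible_one_S3: "totally_irreducible S3 \<one>\<^bsub>S3\<^esub>"
  by (auto simp: totally_irreducible_def S3_def)

end

theory Submission
  imports Defs
begin

text \<open>
  Represent \<open>L\<close> by up-sets over a poset \<open>X\<close> with equivalence \<open>E\<close>. Sending \<open>a\<^sub>-\<^sub>1\<close> to the empty
  relation and \<open>a\<^sub>1\<close> to the full relation respects their order and negations, but \<open>a\<^sub>1 \<cdot> l = a\<^sub>1\<close>
  fails if the relation of \<open>l\<close> has an empty row or column, and \<open>a\<^sub>1\<close> and \<open>a\<^sub>-\<^sub>1\<close> must differ from
  the bounds of \<open>L\<close>. Both defects are cured by enlarging the poset: to every block of \<open>E\<close> are added
  a two-element antichain \<open>{p, q}\<close> above the block and a two-element antichain \<open>{p', q'}\<close> below it.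
  The automorphism \<open>\<alpha>\<close> is extended by exchanging \<open>p\<close> with \<open>q\<close> and \<open>p'\<close> with \<open>q'\<close>, the dual
  automorphism \<open>\<beta>\<close> by exchanging \<open>p\<close> with \<open>p'\<close> and \<open>q\<close> with \<open>q'\<close>. A relation \<open>R\<close> on \<open>X\<close> is
  enlarged to \<open>R \<union> T\<close>, where \<open>T\<close> consists of all order relationships that involve a new point.

  The map \<open>R \<mapsto> R \<union> T\<close> is an embedding of algebras of up-sets.
  \<^item> It respects composition (\<open>enlarge_comp\<close>): a path between two points of \<open>X\<close> cannot pass
    through a new point, since such a point would be both above and below a point of \<open>X\<close>; and \<open>T\<close>
    is reflexive at the new points and transitive.
  \<^item> It respects \<open>\<sim>\<close> and \<open>-\<close> (\<open>enlarge_tilde\<close>, \<open>enlarge_dash\<close>): outside \<open>X\<close> this means that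
    \<open>(u, \<alpha> w) \<in> T\<close> holds exactly if \<open>(w, u) \<notin> T\<close>. This is what the antichains are for. Two points
    in different ones of the three layers (the pair above, the block, the pair below) are related
    in exactly one direction, and \<open>\<alpha>\<close> preserves layers; on \<open>{p, q}\<close> and on \<open>{p', q'}\<close> the
    relation \<open>T\<close> is the identity and \<open>\<alpha>\<close> is the exchange, as in the two-point representation of
    \<open>S3\<close>. Since \<open>\<beta>\<close> reverses \<open>T\<close>, the negation \<open>\<not>\<close> is respected for the same reason
    (\<open>enlarge_neg\<close>).
  \<^item> Each point is above \<open>p'\<close> or \<open>q'\<close> and below \<open>p\<close> or \<open>q\<close>, and \<open>T\<close> is reflexive there, so the
    full relation absorbs every \<open>R \<union> T\<close> on either side, even if \<open>R\<close> is empty (\<open>EY_comp_enlarge\<close>,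
    \<open>enlarge_comp_EY\<close>).
  \<^item> \<open>R \<union> T\<close> is neither empty nor full, so the images of \<open>a\<^sub>-\<^sub>1\<close> and \<open>a\<^sub>1\<close> are new.

  The new poset is finite if \<open>X\<close> is, because a finite set has finitely many blocks. That the nested
  sum is a DqRA (\<open>dqra_nested_sum_S3\<close>) is a computation: any instance of an axiom that involves
  \<open>a\<^sub>1\<close> or \<open>a\<^sub>-\<^sub>1\<close> holds by the operation tables of \<open>S3\<close> and the idempotent and absorption laws of
  \<open>L\<close>, and the other instances are axioms of \<open>L\<close>.
\<close>

section \<open>Linear negations and residuals\<close>

context lattice_reduct
begin

lemma vee_idem: "x \<in> carrier A \<Longrightarrow> vee A x x = x"
  by (metis wedge_absorb vee_absorb vee_closed)

lemma wedge_idem: "x \<in> carrier A \<Longrightarrow> wedge A x x = x"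
  by (metis wedge_absorb vee_absorb wedge_closed)

lemma vee_absorb_left: "x \<in> carrier A \<Longrightarrow> y \<in> carrier A \<Longrightarrow> vee A (wedge A x y) x = x"
  by (metis vee_absorb vee_comm wedge_closed)

lemma leq_refl: "x \<in> carrier A \<Longrightarrow> leq A x x"
  by (simp add: leq_def wedge_idem)

lemma leq_antisym: "x \<in> carrier A \<Longrightarrow> y \<in> carrier A \<Longrightarrow> leq A x y \<Longrightarrow> leq A y x \<Longrightarrow> x = y"
  unfolding leq_def by (metis wedge_comm)

end

context infl_algebra
begin

lemma tilde_dash: "c \<in> carrier A \<Longrightarrow> tilde A (dash A c) = c"
  using resid_under[OF one_closed] leq_refl leq_antisym
  unfolding under_def by (metis dash_closed l_one r_one tilde_closed)

lemma dash_tilde: "c \<in> carrier A \<Longrightarrow> dash A (tilde A c) = c"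
  using resid_over[OF _ one_closed] leq_refl leq_antisym
  unfolding over_def by (metis dash_closed l_one r_one tilde_closed)

text \<open>
  The negations of a nested sum are defined as residuals into the zero element; these two facts
  identify them on \<open>L\<close> with the negations of \<open>L\<close>.
\<close>

lemma under_zero: "x \<in> carrier A \<Longrightarrow> under A x (zero A) = tilde A x"
  unfolding under_def by (metis dash_tilde l_one one_closed zero_tilde)

lemma over_zero: "x \<in> carrier A \<Longrightarrow> over A (zero A) x = dash A x"
  unfolding over_def by (metis tilde_dash r_one one_closed zero_dash)

end

section \<open>The nested sum is a DqRA\<close>

lemma S3_carrier: "carrier S3 - {\<one>\<^bsub>S3\<^esub>} = {-1, 1}"
  by (auto simp: S3_def)

lemma nested_sum_S3_carrier:
  "m \<in> carrier (nested_sum S3 L) \<longleftrightarrow> m = Inl (-1) \<or> m = Inl 1 \<or> (\<exists>l\<in>carrier L. m = Inr l)"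
  by (auto simp: nested_sum_def S3_carrier)

lemma nested_sum_S3_simps [simp]:
  "\<one>\<^bsub>nested_sum S3 L\<^esub> = Inr \<one>\<^bsub>L\<^esub>"
  "zero (nested_sum S3 L) = Inr (zero L)"
  "neg (nested_sum S3 L) (Inl k) = Inl (- k)"
  "neg (nested_sum S3 L) (Inr l) = Inr (neg L l)"
  "tilde (nested_sum S3 L) (Inl k) = Inl (- k)"
  "dash (nested_sum S3 L) (Inl k) = Inl (- k)"
  "Inl k \<otimes>\<^bsub>nested_sum S3 L\<^esub> Inl k' = Inl (k \<otimes>\<^bsub>S3\<^esub> k')"
  "Inr l \<otimes>\<^bsub>nested_sum S3 L\<^esub> Inr l' = Inr (l \<otimes>\<^bsub>L\<^esub> l')"
  "Inl k \<otimes>\<^bsub>nested_sum S3 L\<^esub> Inr l = Inl k"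
  "Inr l \<otimes>\<^bsub>nested_sum S3 L\<^esub> Inl k = Inl k"
  "wedge (nested_sum S3 L) (Inl k) (Inl k') = Inl (min k k')"
  "wedge (nested_sum S3 L) (Inr l) (Inr l') = Inr (wedge L l l')"
  "wedge (nested_sum S3 L) (Inl k) (Inr l) = (if 0 \<le> k then Inr l else Inl k)"
  "wedge (nested_sum S3 L) (Inr l) (Inl k) = (if 0 \<le> k then Inr l else Inl k)"
  "vee (nested_sum S3 L) (Inl k) (Inl k') = Inl (max k k')"
  "vee (nested_sum S3 L) (Inr l) (Inr l') = Inr (vee L l l')"
  "vee (nested_sum S3 L) (Inl k) (Inr l) = (if k \<le> 0 then Inr l else Inl k)"
  "vee (nested_sum S3 L) (Inr l) (Inl k) = (if k \<le> 0 then Inr l else Inl k)"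
  by (auto simp: nested_sum_def S3_def nested_under_def nested_over_def under_def over_def leq_def)

lemma (in infl_algebra) nested_sum_S3_linear_negations [simp]:
  assumes "l \<in> carrier A"
  shows "tilde (nested_sum S3 A) (Inr l) = Inr (tilde A l)"
    and "dash (nested_sum S3 A) (Inr l) = Inr (dash A l)"
  using assms by (simp_all add: nested_sum_def nested_under_def nested_over_def under_zero over_zero)

lemma S3_mult: "i \<otimes>\<^bsub>S3\<^esub> j = (if \<bar>j\<bar> < \<bar>i\<bar> then i else if \<bar>i\<bar> < \<bar>j\<bar> then j else min i j)"
  by (simp add: S3_def)

lemma dqra_nested_sum_S3:
  assumes "dqra L"
  shows "dqra (nested_sum S3 L)"
proof -
  interpret L: dqra L by fact
  note closed = L.wedge_closed L.vee_closed L.tilde_closed L.dash_closed L.neg_closed L.zero_closed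
  note lattice = L.wedge_idem L.vee_idem L.wedge_assoc L.vee_assoc L.wedge_absorb L.vee_absorb
    L.vee_absorb_left L.wedge_vee_distrib
  note negations = L.zero_dash [symmetric] L.zero_tilde [symmetric] L.neg_neg L.neg_vee L.neg_tilde
    L.neg_mult [unfolded dual_plus_def]
  \<comment> \<open>The two residuation laws rewrite the same left-hand side and must not be used together.\<close>
  note over = L.resid_over [unfolded leq_def over_def]
  note under = L.resid_under [unfolded leq_def under_def]
  show ?thesis
    apply unfold_locales
    unfolding nested_sum_S3_carrier leq_def over_def under_def dual_plus_def
    \<comment> \<open>The first alternative settles the instances decided by the tables of \<open>S3\<close>; the others
      reduce an instance to laws of \<open>L\<close>.\<close>
    apply ((elim disjE bexE)?; hypsubst?;
      ((simp add: closed S3_mult; fail)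
      | (simp add: closed L.m_assoc lattice negations over; fail)
      | (simp add: closed under; fail)
      | (simp add: L.wedge_comm L.vee_comm; fail)))+
    done
qed

section \<open>Membership in the operations of a concrete algebra\<close>

lemma fun_graph_cong: "(\<And>x. x \<in> X \<Longrightarrow> f x = g x) \<Longrightarrow> fun_graph X f = fun_graph X g"
  by (force simp: fun_graph_def)

lemma fun_graph_comp:
  "f ` X \<subseteq> X \<Longrightarrow> fun_graph X f O fun_graph X g = fun_graph X (\<lambda>x. g (f x))"
  by (auto simp: fun_graph_def)

context dq_frame
begin

abbreviation "D \<equiv> Dq X leX E \<alpha> \<beta>"

lemma Dq_simps [simp]:
  "carrier D = Up leX E" "\<one>\<^bsub>D\<^esub> = leX"
  "R \<otimes>\<^bsub>D\<^esub> S = R O S" "wedge D R S = R \<inter> S" "vee D R S = R \<union> S"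
  by (simp_all add: Dq_def)

lemma E_subset: "E \<subseteq> X \<times> X"
  using equiv by (simp add: equiv_def)

lemma E_D: "(x, y) \<in> E \<Longrightarrow> x \<in> X \<and> y \<in> X"
  using E_subset by auto

lemma \<alpha>_in: "x \<in> X \<Longrightarrow> \<alpha> x \<in> X"
  using \<alpha>_bij by (auto simp: bij_betw_def)

lemma \<beta>_in: "x \<in> X \<Longrightarrow> \<beta> x \<in> X"
  using \<beta>_bij by (auto simp: bij_betw_def)

lemma \<alpha>_surj: "y \<in> X \<Longrightarrow> \<exists>x\<in>X. y = \<alpha> x"
  using \<alpha>_bij by (auto simp: bij_betw_def)

lemma \<alpha>_inj: "x \<in> X \<Longrightarrow> y \<in> X \<Longrightarrow> \<alpha> x = \<alpha> y \<longleftrightarrow> x = y"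
  using \<alpha>_bij by (auto simp: bij_betw_def inj_on_def)

lemma \<beta>_eq: "x \<in> X \<Longrightarrow> \<beta> x = \<alpha> (\<beta> (\<alpha> x))"
proof -
  assume "x \<in> X"
  then have "(x, \<beta> x) \<in> fun_graph X \<alpha> O fun_graph X \<beta> O fun_graph X \<alpha>"
    using \<beta>_\<alpha> by (auto simp: fun_graph_def)
  then show ?thesis
    by (auto simp: fun_graph_def)
qed

text \<open>
  Points are taken in the form \<open>\<alpha> w\<close> to avoid the inverse of \<open>\<alpha>\<close>; this is no restriction, as \<open>\<alpha>\<close>
  permutes \<open>X\<close>.
\<close>

lemma in_tilde: "w \<in> X \<Longrightarrow> (u, \<alpha> w) \<in> tilde D R \<longleftrightarrow> (w, u) \<in> E - R"
  using E_D \<alpha>_inj by (fastforce simp: Dq_def fun_graph_def)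

lemma in_dash: "(u, v) \<in> dash D R \<longleftrightarrow> u \<in> X \<and> (v, \<alpha> u) \<in> E - R"
  by (auto simp: Dq_def fun_graph_def)

lemma in_neg: "(u, v) \<in> neg D R \<longleftrightarrow> u \<in> X \<and> v \<in> X \<and> (\<beta> (\<alpha> u), \<beta> v) \<in> E - R"
proof
  assume "(u, v) \<in> neg D R"
  then obtain w where "u \<in> X" "w \<in> X" "v = \<beta> w" "(\<beta> (\<alpha> u), w) \<in> E - R"
    by (auto simp: Dq_def fun_graph_def)
  then show "u \<in> X \<and> v \<in> X \<and> (\<beta> (\<alpha> u), \<beta> v) \<in> E - R"
    using \<beta>_in \<beta>_self_inverse by auto
next
  assume R: "u \<in> X \<and> v \<in> X \<and> (\<beta> (\<alpha> u), \<beta> v) \<in> E - R"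
  then have "(u, \<alpha> u) \<in> fun_graph X \<alpha>" "(\<alpha> u, \<beta> (\<alpha> u)) \<in> fun_graph X \<beta>"
    "(\<beta> v, v) \<in> fun_graph X \<beta>"
    using \<alpha>_in \<beta>_in \<beta>_self_inverse[of v] by (auto simp: fun_graph_def)
  then show "(u, v) \<in> neg D R"
    using R unfolding Dq_def by auto
qed

lemma tilde_subset: "tilde D R \<subseteq> X \<times> X"
  using E_D \<alpha>_in by (fastforce simp: Dq_def fun_graph_def)

lemma tilde_eqI:
  assumes "S \<subseteq> X \<times> X"
    and "\<And>u w. u \<in> X \<Longrightarrow> w \<in> X \<Longrightarrow> (u, \<alpha> w) \<in> S \<longleftrightarrow> (w, u) \<in> E - R"
  shows "tilde D R = S"
proof -
  have "(u, v) \<in> tilde D R \<longleftrightarrow> (u, v) \<in> S" for u v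
  proof (cases "u \<in> X \<and> v \<in> X")
    case True
    with \<alpha>_surj obtain w where "w \<in> X" "v = \<alpha> w" by blast
    with True show ?thesis
      by (simp add: in_tilde assms(2))
  qed (use assms(1) tilde_subset in blast)
  then show ?thesis by auto
qed

lemma dash_eqI:
  assumes "S \<subseteq> X \<times> X"
    and "\<And>u v. u \<in> X \<Longrightarrow> v \<in> X \<Longrightarrow> (u, v) \<in> S \<longleftrightarrow> (v, \<alpha> u) \<in> E - R"
  shows "dash D R = S"
proof -
  have "(u, v) \<in> dash D R \<longleftrightarrow> (u, v) \<in> S" for u v
    unfolding in_dash using assms E_D by blast
  then show ?thesis by auto
qed

lemma neg_eqI:
  assumes "S \<subseteq> X \<times> X"
    and "\<And>u v. u \<in> X \<Longrightarrow> v \<in> X \<Longrightarrow> (u, v) \<in> S \<longleftrightarrow> (\<beta> (\<alpha> u), \<beta> v) \<in> E - R"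
  shows "neg D R = S"
proof -
  have "(u, v) \<in> neg D R \<longleftrightarrow> (u, v) \<in> S" for u v
    unfolding in_neg using assms by blast
  then show ?thesis by auto
qed

lemma E_sym: "(x, y) \<in> E \<Longrightarrow> (y, x) \<in> E"
  using equiv by (meson equiv_def symE)

lemma E_trans: "(x, y) \<in> E \<Longrightarrow> (y, z) \<in> E \<Longrightarrow> (x, z) \<in> E"
  using equiv by (meson equiv_def transD)

lemma E_\<alpha>: "x \<in> X \<Longrightarrow> (x, \<alpha> x) \<in> E"
  using \<alpha>_E by (auto simp: fun_graph_def)

lemma E_\<beta>: "x \<in> X \<Longrightarrow> (x, \<beta> x) \<in> E"
  using \<beta>_E by (auto simp: fun_graph_def)

lemma E_\<alpha>_iff: "w \<in> X \<Longrightarrow> (u, \<alpha> w) \<in> E \<longleftrightarrow> (w, u) \<in> E"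
  by (meson E_\<alpha> E_sym E_trans)

lemma E_\<beta>\<alpha>_iff: "u \<in> X \<Longrightarrow> v \<in> X \<Longrightarrow> (\<beta> (\<alpha> u), \<beta> v) \<in> E \<longleftrightarrow> (u, v) \<in> E"
  by (meson E_\<alpha> E_\<beta> E_sym E_trans \<alpha>_in)

lemma negations_E:
  "tilde D E = {}" "dash D E = {}" "neg D E = {}"
  by (simp_all add: Dq_def)

lemma negations_empty:
  "tilde D {} = E" "dash D {} = E" "neg D {} = E"
proof -
  show "tilde D {} = E"
    using E_subset by (intro tilde_eqI) (simp_all add: E_\<alpha>_iff)
  show "dash D {} = E"
    using E_subset by (intro dash_eqI) (simp_all add: E_\<alpha>_iff)
  show "neg D {} = E"
    using E_subset by (intro neg_eqI) (simp_all add: E_\<beta>\<alpha>_iff)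
qed

lemma zero_eq_dash: "zero D = dash D leX"
  by (simp add: Dq_def)

lemma empty_in_Up: "{} \<in> Up leX E" and E_in_Up: "E \<in> Up leX E"
  by (auto simp: Up_def)

end


section \<open>Representations as embeddings\<close>

text \<open>
  An isomorphism onto a subalgebra carries the same information as an embedding, whose image need
  not be named.
\<close>

definition qra_embedding :: "('a, 'c) qra_scheme \<Rightarrow> ('b, 'd) qra_scheme \<Rightarrow> ('a \<Rightarrow> 'b) \<Rightarrow> bool" where
  "qra_embedding A B h \<longleftrightarrow> inj_on h (carrier A) \<and> h ` carrier A \<subseteq> carrier B
    \<and> h \<one>\<^bsub>A\<^esub> = \<one>\<^bsub>B\<^esub> \<and> h (zero A) = zero B
    \<and> (\<forall>x\<in>carrier A. h (tilde A x) = tilde B (h x) \<and> h (dash A x) = dash B (h x)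
          \<and> h (neg A x) = neg B (h x))
    \<and> (\<forall>x\<in>carrier A. \<forall>y\<in>carrier A. h (wedge A x y) = wedge B (h x) (h y)
          \<and> h (vee A x y) = vee B (h x) (h y) \<and> h (x \<otimes>\<^bsub>A\<^esub> y) = h x \<otimes>\<^bsub>B\<^esub> h y)"

lemma carrier_update_simps:
  fixes B :: "('b, 'd) qra_scheme"
  shows "carrier (B\<lparr>carrier := S\<rparr>) = S" "\<one>\<^bsub>B\<lparr>carrier := S\<rparr>\<^esub> = \<one>\<^bsub>B\<^esub>"
    "zero (B\<lparr>carrier := S\<rparr>) = zero B" "tilde (B\<lparr>carrier := S\<rparr>) = tilde B"
    "dash (B\<lparr>carrier := S\<rparr>) = dash B" "neg (B\<lparr>carrier := S\<rparr>) = neg B"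
    "wedge (B\<lparr>carrier := S\<rparr>) = wedge B" "vee (B\<lparr>carrier := S\<rparr>) = vee B"
    "mult (B\<lparr>carrier := S\<rparr>) = mult B"
  by (cases B; simp)+

lemma represented_on_embedding:
  assumes "represented_on X A"
  obtains leX E \<alpha> \<beta> h where "dq_frame X leX E \<alpha> \<beta>" "qra_embedding A (Dq X leX E \<alpha> \<beta>) h"
proof -
  from assms obtain leX E \<alpha> \<beta> S h where frame: "dq_frame X leX E \<alpha> \<beta>"
    and S: "qra_subalgebra S (Dq X leX E \<alpha> \<beta>)"
    and h: "h \<in> qra_iso A (Dq X leX E \<alpha> \<beta>\<lparr>carrier := S\<rparr>)"
    unfolding represented_on_def qra_isomorphic_def by blast
  have "qra_embedding A (Dq X leX E \<alpha> \<beta>) h"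
    using h S unfolding qra_embedding_def qra_iso_def qra_subalgebra_def carrier_update_simps
    by (simp add: bij_betw_def)
  with frame show thesis by (rule that)
qed

lemma represented_onI:
  assumes A: "quasi_relation_algebra A" and frame: "dq_frame X leX E \<alpha> \<beta>"
    and h: "qra_embedding A (Dq X leX E \<alpha> \<beta>) h"
  shows "represented_on X A"
proof -
  interpret A: quasi_relation_algebra A by fact
  let ?B = "Dq X leX E \<alpha> \<beta>" and ?S = "h ` carrier A"
  have one: "\<one>\<^bsub>?B\<^esub> = h \<one>\<^bsub>A\<^esub>" and zero: "zero ?B = h (zero A)"
    and unary: "\<And>a. a \<in> carrier A \<Longrightarrow> tilde ?B (h a) = h (tilde A a)
      \<and> dash ?B (h a) = h (dash A a) \<and> neg ?B (h a) = h (neg A a)"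
    and binary: "\<And>a b. a \<in> carrier A \<Longrightarrow> b \<in> carrier A \<Longrightarrow> wedge ?B (h a) (h b) = h (wedge A a b)
      \<and> vee ?B (h a) (h b) = h (vee A a b) \<and> h a \<otimes>\<^bsub>?B\<^esub> h b = h (a \<otimes>\<^bsub>A\<^esub> b)"
    using h unfolding qra_embedding_def by simp_all
  have "qra_subalgebra ?S ?B"
    unfolding qra_subalgebra_def
  proof (intro conjI)
    show "?S \<subseteq> carrier ?B"
      using h by (simp add: qra_embedding_def)
    show "\<one>\<^bsub>?B\<^esub> \<in> ?S" "zero ?B \<in> ?S"
      by (simp_all add: one zero A.one_closed A.zero_closed)
    show "\<forall>x\<in>?S. tilde ?B x \<in> ?S \<and> dash ?B x \<in> ?S \<and> neg ?B x \<in> ?S"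
      by (simp add: unary A.tilde_closed A.dash_closed A.neg_closed)
    show "\<forall>x\<in>?S. \<forall>y\<in>?S. wedge ?B x y \<in> ?S \<and> vee ?B x y \<in> ?S \<and> x \<otimes>\<^bsub>?B\<^esub> y \<in> ?S"
      by (simp add: binary A.wedge_closed A.vee_closed A.m_closed)
  qed
  moreover have "h \<in> qra_iso A (?B\<lparr>carrier := ?S\<rparr>)"
    using h unfolding qra_embedding_def qra_iso_def carrier_update_simps
    by (simp add: bij_betw_def)
  ultimately show ?thesis
    using frame unfolding represented_on_def qra_isomorphic_def by blast
qed

section \<open>The levels of the enlarged poset\<close>

text \<open>
  Level 0 stands for the given poset. The antichain above it has the levels 1 and 2, the antichain
  below it has the levels 3 and 4.
\<close>

definition level_le :: "nat \<Rightarrow> nat \<Rightarrow> bool" where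
  "level_le m n \<longleftrightarrow> m = n \<or> m \<in> {3, 4} \<and> n \<in> {0, 1, 2} \<or> m = 0 \<and> n \<in> {1, 2}"

definition level_\<alpha> :: "nat \<Rightarrow> nat" where
  "level_\<alpha> n = (if n = 0 then 0 else if n = 1 then 2 else if n = 2 then 1 else if n = 3 then 4 else 3)"

definition level_\<beta> :: "nat \<Rightarrow> nat" where
  "level_\<beta> n = (if n = 0 then 0 else if n = 1 then 3 else if n = 2 then 4 else if n = 3 then 1 else 2)"

lemma level_cases: "n \<le> 4 \<Longrightarrow> n = 0 \<or> n = 1 \<or> n = 2 \<or> n = 3 \<or> n = (4::nat)"
  by arith

lemma level_le_refl [simp]: "level_le n n"
  by (simp add: level_le_def)

lemma level_le_trans: "level_le m n \<Longrightarrow> level_le n k \<Longrightarrow> level_le m k"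
  by (auto simp: level_le_def)

lemma level_le_antisym: "level_le m n \<Longrightarrow> level_le n m \<Longrightarrow> m = n"
  by (auto simp: level_le_def)

lemma level_le_extremal:
  "n \<noteq> 4 \<Longrightarrow> n \<le> 4 \<Longrightarrow> level_le 3 n" "n \<noteq> 2 \<Longrightarrow> n \<le> 4 \<Longrightarrow> level_le n 1"
  using level_cases[of n] by (auto simp: level_le_def)

lemma level_\<alpha>_simps [simp]:
  "level_\<alpha> 0 = 0" "level_\<alpha> n = 0 \<longleftrightarrow> n = 0" "0 < level_\<alpha> n \<longleftrightarrow> 0 < n" "level_\<alpha> n \<le> 4"
  by (auto simp: level_\<alpha>_def)

lemma level_\<beta>_simps [simp]:
  "level_\<beta> 0 = 0" "level_\<beta> n = 0 \<longleftrightarrow> n = 0" "0 < level_\<beta> n \<longleftrightarrow> 0 < n" "level_\<beta> n \<le> 4"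
  by (auto simp: level_\<beta>_def)

lemma level_\<alpha>_self_inverse: "n \<le> 4 \<Longrightarrow> level_\<alpha> (level_\<alpha> n) = n"
  and level_\<beta>_self_inverse: "n \<le> 4 \<Longrightarrow> level_\<beta> (level_\<beta> n) = n"
  and level_\<beta>_\<alpha>: "n \<le> 4 \<Longrightarrow> level_\<alpha> (level_\<beta> (level_\<alpha> n)) = level_\<beta> n"
  by (drule level_cases, auto simp: level_\<alpha>_def level_\<beta>_def)+

text \<open>
  The duality \<open>level_le_dual\<close> is the reason for using antichains of two elements, and it makes the
  enlargement compatible with all three negations. It fails for \<open>m = n = 0\<close>, where a given relation
  decides.
\<close>

lemma
  assumes "m \<le> 4" "n \<le> 4"
  shows level_le_\<alpha>: "level_le (level_\<alpha> m) (level_\<alpha> n) \<longleftrightarrow> level_le m n"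
    and level_le_\<beta>: "level_le (level_\<beta> m) (level_\<beta> n) \<longleftrightarrow> level_le n m"
    and level_le_dual: "m \<noteq> 0 \<or> n \<noteq> 0 \<Longrightarrow> level_le n (level_\<alpha> m) \<longleftrightarrow> \<not> level_le m n"
  using level_cases[OF assms(1)] level_cases[OF assms(2)]
  by (elim disjE; simp add: level_le_def level_\<alpha>_def level_\<beta>_def)+

section \<open>The enlarged frame\<close>

text \<open>
  The function \<open>c\<close> picks a name in \<open>J\<close> for each block of \<open>E\<close>, and new points are added for every
  name: the points of the enlarged poset are \<open>(x, 0)\<close> for \<open>x\<close> in \<open>X\<close>, and \<open>(j, n)\<close> with a level
  \<open>n \<ge> 1\<close> for a name \<open>j\<close>. Names that belong to no block are harmless, and needed if \<open>X\<close> is empty: without any new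
  point, the empty and the full relation would coincide.
\<close>

locale enlarged_frame = dq_frame X leX E \<alpha> \<beta>
  for X :: "'x set" and leX E \<alpha> \<beta> +
  fixes c :: "'x \<Rightarrow> 'x" and J :: "'x set"
  assumes E_iff: "(x, y) \<in> E \<longleftrightarrow> x \<in> X \<and> y \<in> X \<and> c x = c y"
    and c_in: "x \<in> X \<Longrightarrow> c x \<in> J"
    and J_nonempty: "J \<noteq> {}"
begin

definition Y :: "('x \<times> nat) set" where
  "Y = X \<times> {0} \<union> J \<times> {1..4}"

definition block :: "'x \<times> nat \<Rightarrow> 'x" where
  "block u = (if snd u = 0 then c (fst u) else fst u)"

definition EY :: "('x \<times> nat) rel" where
  "EY = {(u, v). u \<in> Y \<and> v \<in> Y \<and> block u = block v}"

definition enlarge :: "'x rel \<Rightarrow> ('x \<times> nat) rel" where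
  "enlarge R = {(u, v) \<in> EY.
     if snd u = 0 \<and> snd v = 0 then (fst u, fst v) \<in> R else level_le (snd u) (snd v)}"

definition \<alpha>Y :: "'x \<times> nat \<Rightarrow> 'x \<times> nat" where
  "\<alpha>Y u = (if snd u = 0 then \<alpha> (fst u) else fst u, level_\<alpha> (snd u))"

definition \<beta>Y :: "'x \<times> nat \<Rightarrow> 'x \<times> nat" where
  "\<beta>Y u = (if snd u = 0 then \<beta> (fst u) else fst u, level_\<beta> (snd u))"

lemma in_enlarge:
  "(u, v) \<in> enlarge R \<longleftrightarrow> (u, v) \<in> EY \<and>
     (if snd u = 0 \<and> snd v = 0 then (fst u, fst v) \<in> R else level_le (snd u) (snd v))"
  by (simp add: enlarge_def)

lemma level_le_4: "u \<in> Y \<Longrightarrow> snd u \<le> 4"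
  by (auto simp: Y_def)

lemma fst_in_X: "u \<in> Y \<Longrightarrow> snd u = 0 \<Longrightarrow> fst u \<in> X"
  by (auto simp: Y_def)

lemma block_in_J: "u \<in> Y \<Longrightarrow> block u \<in> J"
  by (auto simp: Y_def block_def c_in)

lemma c_\<alpha>: "x \<in> X \<Longrightarrow> c (\<alpha> x) = c x"
  and c_\<beta>: "x \<in> X \<Longrightarrow> c (\<beta> x) = c x"
  using E_\<alpha> E_\<beta> E_iff by metis+

lemma \<alpha>Y_in: "u \<in> Y \<Longrightarrow> \<alpha>Y u \<in> Y"
  and \<beta>Y_in: "u \<in> Y \<Longrightarrow> \<beta>Y u \<in> Y"
  by (auto simp: Y_def \<alpha>Y_def \<beta>Y_def \<alpha>_in \<beta>_in Suc_le_eq)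

lemma block_\<alpha>Y: "u \<in> Y \<Longrightarrow> block (\<alpha>Y u) = block u"
  and block_\<beta>Y: "u \<in> Y \<Longrightarrow> block (\<beta>Y u) = block u"
  by (auto simp: block_def Y_def \<alpha>Y_def \<beta>Y_def c_\<alpha> c_\<beta>)

lemma \<alpha>Y_bij: "bij_betw \<alpha>Y Y Y"
proof (rule bij_betw_byWitness)
  let ?g = "\<lambda>u. (if snd u = 0 then inv_into X \<alpha> (fst u) else fst u, level_\<alpha> (snd u))"
  note inv = bij_betw_inv_into_left[OF \<alpha>_bij] bij_betw_inv_into_right[OF \<alpha>_bij]
    bij_betwE[OF bij_betw_inv_into[OF \<alpha>_bij]]
  show "\<forall>u\<in>Y. ?g (\<alpha>Y u) = u" "\<forall>u\<in>Y. \<alpha>Y (?g u) = u"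
    by (auto simp: Y_def \<alpha>Y_def inv level_\<alpha>_self_inverse)
  show "\<alpha>Y ` Y \<subseteq> Y" using \<alpha>Y_in by auto
  show "?g ` Y \<subseteq> Y" by (auto simp: Y_def inv Suc_le_eq)
qed

lemma \<beta>Y_self_inverse: "u \<in> Y \<Longrightarrow> \<beta>Y (\<beta>Y u) = u"
  by (auto simp: Y_def \<beta>Y_def \<beta>_self_inverse level_\<beta>_self_inverse)

lemma \<beta>Y_eq: "u \<in> Y \<Longrightarrow> \<beta>Y u = \<alpha>Y (\<beta>Y (\<alpha>Y u))"
  by (auto simp: Y_def \<alpha>Y_def \<beta>Y_def \<beta>_eq[symmetric] level_\<beta>_\<alpha>)

lemma leX_D: "(x, y) \<in> leX \<Longrightarrow> (x, y) \<in> E"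
  using leX_E by auto

lemma EY_D: "(u, v) \<in> EY \<Longrightarrow> u \<in> Y \<and> v \<in> Y"
  by (auto simp: EY_def)

lemma EY_refl: "u \<in> Y \<Longrightarrow> (u, u) \<in> EY"
  by (simp add: EY_def)

lemma EY_trans: "(u, v) \<in> EY \<Longrightarrow> (v, w) \<in> EY \<Longrightarrow> (u, w) \<in> EY"
  by (auto simp: EY_def)

lemma EY_zero: "(u, v) \<in> EY \<Longrightarrow> snd u = 0 \<Longrightarrow> snd v = 0 \<Longrightarrow> (fst u, fst v) \<in> E"
  using fst_in_X by (auto simp: EY_def E_iff block_def)

text \<open>
  Intermediate points of the composite can be chosen at level 0 if both ends are at level 0, and
  have to be, as levels are antisymmetric. Otherwise one end is a new point, at which every
  enlarged relation is reflexive.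
\<close>

lemma enlarge_comp:
  assumes "R \<subseteq> E" "S \<subseteq> E"
  shows "enlarge R O enlarge S = enlarge (R O S)"
proof (intro equalityI subrelI)
  fix u w assume "(u, w) \<in> enlarge R O enlarge S"
  then obtain v where v: "(u, v) \<in> enlarge R" "(v, w) \<in> enlarge S" by blast
  then have uw: "(u, w) \<in> EY"
    using EY_trans unfolding in_enlarge by blast
  show "(u, w) \<in> enlarge (R O S)"
  proof (cases "snd u = 0 \<and> snd w = 0")
    case True
    with v have "snd v = 0"
      by (auto simp: in_enlarge split: if_splits dest: level_le_antisym)
    with True v uw show ?thesis by (auto simp: in_enlarge)
  next
    case False
    from v have "level_le (snd u) (snd v)" "level_le (snd v) (snd w)"
      by (auto simp: in_enlarge split: if_splits)
    then have "level_le (snd u) (snd w)" by (rule level_le_trans)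
    with False uw show ?thesis by (auto simp: in_enlarge)
  qed
next
  fix u w assume uw: "(u, w) \<in> enlarge (R O S)"
  then have Y: "u \<in> Y" "w \<in> Y" using EY_D unfolding in_enlarge by blast+
  consider "snd u = 0" "snd w = 0" | "snd u \<noteq> 0" | "snd w \<noteq> 0" by blast
  then show "(u, w) \<in> enlarge R O enlarge S"
  proof cases
    case 1
    with uw obtain z where z: "(fst u, z) \<in> R" "(z, fst w) \<in> S" by (auto simp: in_enlarge)
    with assms have "(fst u, z) \<in> E" by blast
    with z 1 Y uw have "(u, (z, 0)) \<in> enlarge R" "((z, 0), w) \<in> enlarge S"
      by (auto simp: in_enlarge EY_def Y_def E_iff block_def)
    then show ?thesis by blast
  next
    case 2
    with Y uw have "(u, u) \<in> enlarge R" "(u, w) \<in> enlarge S"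
      by (auto simp: in_enlarge EY_refl)
    then show ?thesis by blast
  next
    case 3
    with Y uw have "(u, w) \<in> enlarge R" "(w, w) \<in> enlarge S"
      by (auto simp: in_enlarge EY_refl)
    then show ?thesis by blast
  qed
qed

text \<open>
  The intermediate point is one of the two minimal new points, at which the enlarged relation is
  reflexive: level 3 lies below all levels except 4, which lies below itself.
\<close>

lemma EY_comp_enlarge: "EY O enlarge R = EY"
proof (intro equalityI subrelI)
  fix u w assume uw: "(u, w) \<in> EY"
  let ?z = "if snd w = 4 then w else (block w, 3)"
  from uw have "?z \<in> Y" "block ?z = block w"
    using EY_D block_in_J by (auto simp: Y_def block_def)
  with uw have "(u, ?z) \<in> EY" "(?z, w) \<in> enlarge R"
    using level_le_extremal(1)[of "snd w"] level_le_4[of w] by (auto simp: EY_def in_enlarge)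
  then show "(u, w) \<in> EY O enlarge R" by blast
qed (use EY_trans in \<open>auto simp: in_enlarge\<close>)

text \<open>Dually, level 1 lies above all levels except 2.\<close>

lemma enlarge_comp_EY: "enlarge R O EY = EY"
proof (intro equalityI subrelI)
  fix u w assume uw: "(u, w) \<in> EY"
  let ?z = "if snd u = 2 then u else (block u, 1)"
  from uw have "?z \<in> Y" "block ?z = block u"
    using EY_D block_in_J by (auto simp: Y_def block_def)
  with uw have "(u, ?z) \<in> enlarge R" "(?z, w) \<in> EY"
    using level_le_extremal(2)[of "snd u"] level_le_4[of u] by (auto simp: EY_def in_enlarge)
  then show "(u, w) \<in> enlarge R O EY" by blast
qed (use EY_trans in \<open>auto simp: in_enlarge\<close>)

lemma EY_comp_EY: "EY O EY = EY"
  using EY_refl EY_trans EY_D by (intro equalityI subrelI) blast+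

lemma frame_Y: "dq_frame Y (enlarge leX) EY \<alpha>Y \<beta>Y"
proof
  have leX: "leX \<subseteq> X \<times> X" "\<And>x. x \<in> X \<Longrightarrow> (x, x) \<in> leX" "leX O leX \<subseteq> leX" "antisym leX"
    using poset by (auto simp: partial_order_on_def preorder_on_def refl_on_def dest: transD)
  have "refl_on Y (enlarge leX)"
    using leX(2) fst_in_X by (auto simp: refl_on_def in_enlarge EY_refl)
  moreover have "trans (enlarge leX)"
  proof (rule transI)
    fix u v w assume "(u, v) \<in> enlarge leX" "(v, w) \<in> enlarge leX"
    then have "(u, w) \<in> enlarge (leX O leX)"
      using enlarge_comp[OF leX_E leX_E] by blast
    then show "(u, w) \<in> enlarge leX"
      using leX(3) by (auto simp: in_enlarge split: if_splits)
  qed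
  moreover have "antisym (enlarge leX)"
  proof (rule antisymI)
    fix u v assume uv: "(u, v) \<in> enlarge leX" "(v, u) \<in> enlarge leX"
    then have level: "snd u = snd v"
      using level_le_antisym by (auto simp: in_enlarge split: if_splits)
    moreover have "fst u = fst v"
    proof (cases "snd u = 0")
      case True
      with level uv show ?thesis
        using antisymD[OF leX(4)] by (auto simp: in_enlarge)
    next
      case False
      with level uv show ?thesis by (auto simp: in_enlarge EY_def block_def)
    qed
    ultimately show "u = v" by (rule prod_eqI[rotated])
  qed
  ultimately show "partial_order_on Y (enlarge leX)"
    using EY_D by (auto simp: partial_order_on_def preorder_on_def in_enlarge)
  show "equiv Y EY"
    by (rule equivI) (auto simp: EY_def refl_on_def sym_def trans_def)
  show "enlarge leX \<subseteq> EY" by (auto simp: in_enlarge)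
  show "bij_betw \<alpha>Y Y Y" by (rule \<alpha>Y_bij)
  show "bij_betw \<beta>Y Y Y"
    using \<beta>Y_in \<beta>Y_self_inverse by (intro bij_betw_byWitness[where f' = \<beta>Y]) auto
  fix u v assume uv: "u \<in> Y" "v \<in> Y"
  show "(\<alpha>Y u, \<alpha>Y v) \<in> enlarge leX \<longleftrightarrow> (u, v) \<in> enlarge leX"
    using uv fst_in_X[of u] fst_in_X[of v] level_le_4[of u] level_le_4[of v]
    by (auto simp: in_enlarge EY_def \<alpha>Y_in block_\<alpha>Y) (auto simp: \<alpha>Y_def \<alpha>_order level_le_\<alpha>)
  show "(\<beta>Y u, \<beta>Y v) \<in> enlarge leX \<longleftrightarrow> (v, u) \<in> enlarge leX"
    using uv fst_in_X[of u] fst_in_X[of v] level_le_4[of u] level_le_4[of v]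
    by (auto simp: in_enlarge EY_def \<beta>Y_in block_\<beta>Y) (auto simp: \<beta>Y_def \<beta>_order level_le_\<beta>)
  show "\<beta>Y (\<beta>Y u) = u" by (rule \<beta>Y_self_inverse) fact
next
  show "fun_graph Y \<alpha>Y \<subseteq> EY" "fun_graph Y \<beta>Y \<subseteq> EY"
    by (auto simp: fun_graph_def EY_def \<alpha>Y_in \<beta>Y_in block_\<alpha>Y block_\<beta>Y)
  show "fun_graph Y \<beta>Y = fun_graph Y \<alpha>Y O fun_graph Y \<beta>Y O fun_graph Y \<alpha>Y"
    by (simp add: fun_graph_comp image_subset_iff \<alpha>Y_in \<beta>Y_in) (rule fun_graph_cong, rule \<beta>Y_eq)
qed

end

sublocale enlarged_frame \<subseteq> Y: dq_frame Y "enlarge leX" EY \<alpha>Y \<beta>Y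
  by (rule frame_Y)

context enlarged_frame
begin

lemma enlarge_subset: "enlarge R \<subseteq> EY"
  by (auto simp: in_enlarge)

lemma enlarge_subset_Y: "enlarge R \<subseteq> Y \<times> Y"
  using enlarge_subset Y.E_subset by blast

lemma enlarge_mono: "R \<subseteq> S \<Longrightarrow> enlarge R \<subseteq> enlarge S"
  by (auto simp: in_enlarge split: if_splits)

lemma enlarge_Int: "enlarge (R \<inter> S) = enlarge R \<inter> enlarge S"
  and enlarge_Un: "enlarge (R \<union> S) = enlarge R \<union> enlarge S"
  by (auto simp: in_enlarge split: if_splits)

text \<open>
  A relation inside \<open>E\<close> is an up-set exactly if it absorbs the order on both sides, and enlarging
  respects composition.
\<close>

lemma enlarge_in_Up:
  assumes "R \<in> Up leX E"
  shows "enlarge R \<in> Up (enlarge leX) EY"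
proof -
  from assms have R: "R \<subseteq> E" by (simp add: Up_def)
  then have RE: "R O leX \<subseteq> E"
    using leX_D E_trans by blast
  have "leX O R O leX \<subseteq> R"
  proof (rule subrelI)
    fix x y assume "(x, y) \<in> leX O R O leX"
    then obtain u v where xy: "(x, u) \<in> leX" "(u, v) \<in> R" "(v, y) \<in> leX" by blast
    with R have "(x, y) \<in> E" by (meson E_trans leX_D subsetD)
    with xy assms show "(x, y) \<in> R" unfolding Up_def by blast
  qed
  then have sub: "enlarge leX O enlarge R O enlarge leX \<subseteq> enlarge R"
    using R RE leX_E by (simp add: enlarge_comp enlarge_mono)
  have "(x, y) \<in> enlarge R"
    if "(u, v) \<in> enlarge R" "(x, u) \<in> enlarge leX" "(v, y) \<in> enlarge leX" for u v x y
    using sub that by (meson relcompI subsetD)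
  then show ?thesis
    using enlarge_subset unfolding Up_def by blast
qed

lemma enlarge_inj:
  assumes "R \<subseteq> E" "S \<subseteq> E" "enlarge R = enlarge S"
  shows "R = S"
proof -
  have "(x, y) \<in> R \<longleftrightarrow> (x, y) \<in> S" if "(x, y) \<in> E" for x y
  proof -
    from that have "((x, 0), (y, 0)) \<in> EY"
      by (auto simp: EY_def Y_def block_def E_iff)
    then have "(x, y) \<in> R \<longleftrightarrow> ((x, 0), (y, 0)) \<in> enlarge R" "(x, y) \<in> S \<longleftrightarrow> ((x, 0), (y, 0)) \<in> enlarge S"
      by (simp_all add: in_enlarge)
    with assms show ?thesis by simp
  qed
  with assms show ?thesis by auto
qed

lemma enlarge_neq: "enlarge R \<noteq> {}" "enlarge R \<noteq> EY"
proof -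
  from J_nonempty obtain j where "j \<in> J" by blast
  then have "((j, 1), (j, 1)) \<in> enlarge R" "((j, 1), (j, 3)) \<in> EY - enlarge R"
    by (auto simp: in_enlarge EY_def Y_def block_def level_le_def)
  then show "enlarge R \<noteq> {}" "enlarge R \<noteq> EY" by auto
qed

lemma EY_nonempty: "EY \<noteq> {}"
  using enlarge_neq(1) enlarge_subset by blast

text \<open>
  If a new point is involved, membership depends on the levels only, which is why \<open>R\<close> and \<open>S\<close> are
  unrelated.
\<close>

lemma enlarge_complement_\<alpha>Y:
  assumes "u \<in> Y" "w \<in> Y" "snd u \<noteq> 0 \<or> snd w \<noteq> 0"
  shows "(u, \<alpha>Y w) \<in> enlarge R \<longleftrightarrow> (w, u) \<in> EY - enlarge S"
  using assms level_le_dual[of "snd w" "snd u"] level_le_4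
  by (auto simp: in_enlarge Y.E_\<alpha>_iff) (auto simp: \<alpha>Y_def)

lemma enlarge_tilde: "enlarge (tilde D R) = tilde Y.D (enlarge R)"
proof (rule Y.tilde_eqI[symmetric])
  fix u w assume uw: "u \<in> Y" "w \<in> Y"
  show "(u, \<alpha>Y w) \<in> enlarge (tilde D R) \<longleftrightarrow> (w, u) \<in> EY - enlarge R"
  proof (cases "snd u = 0 \<and> snd w = 0")
    case True
    with uw have X: "fst u \<in> X" "fst w \<in> X" using fst_in_X by auto
    from True have \<alpha>: "fst (\<alpha>Y w) = \<alpha> (fst w)" "snd (\<alpha>Y w) = 0" by (auto simp: \<alpha>Y_def)
    have "(u, \<alpha>Y w) \<in> enlarge (tilde D R) \<longleftrightarrow> (w, u) \<in> EY \<and> (fst u, \<alpha> (fst w)) \<in> tilde D R"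
      using True uw by (simp add: in_enlarge Y.E_\<alpha>_iff \<alpha>)
    also have "\<dots> \<longleftrightarrow> (w, u) \<in> EY - enlarge R"
      using True X EY_zero[of w u] by (auto simp: in_enlarge in_tilde)
    finally show ?thesis .
  qed (use uw enlarge_complement_\<alpha>Y in auto)
qed (rule enlarge_subset_Y)

lemma enlarge_dash: "enlarge (dash D R) = dash Y.D (enlarge R)"
proof (rule Y.dash_eqI[symmetric])
  fix u v assume uv: "u \<in> Y" "v \<in> Y"
  show "(u, v) \<in> enlarge (dash D R) \<longleftrightarrow> (v, \<alpha>Y u) \<in> EY - enlarge R"
  proof (cases "snd u = 0 \<and> snd v = 0")
    case True
    with uv have X: "fst u \<in> X" "fst v \<in> X" using fst_in_X by auto
    from True have \<alpha>: "fst (\<alpha>Y u) = \<alpha> (fst u)" "snd (\<alpha>Y u) = 0" by (auto simp: \<alpha>Y_def)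
    show ?thesis
      using True X uv EY_zero[of u v] E_\<alpha>_iff by (auto simp: in_enlarge in_dash Y.E_\<alpha>_iff \<alpha>)
  next
    case False
    then show ?thesis
      using enlarge_complement_\<alpha>Y[of v u R "dash D R"] uv Y.E_\<alpha>_iff[of u v]
        enlarge_subset by blast
  qed
qed (rule enlarge_subset_Y)

lemma enlarge_neg: "enlarge (neg D R) = neg Y.D (enlarge R)"
proof (rule Y.neg_eqI[symmetric])
  fix u v assume uv: "u \<in> Y" "v \<in> Y"
  show "(u, v) \<in> enlarge (neg D R) \<longleftrightarrow> (\<beta>Y (\<alpha>Y u), \<beta>Y v) \<in> EY - enlarge R"
  proof (cases "snd u = 0 \<and> snd v = 0")
    case True
    with uv have X: "fst u \<in> X" "fst v \<in> X" using fst_in_X by auto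
    from True have \<beta>: "fst (\<beta>Y (\<alpha>Y u)) = \<beta> (\<alpha> (fst u))" "snd (\<beta>Y (\<alpha>Y u)) = 0"
      "fst (\<beta>Y v) = \<beta> (fst v)" "snd (\<beta>Y v) = 0" by (auto simp: \<alpha>Y_def \<beta>Y_def)
    show ?thesis
      using True X uv EY_zero[of u v] by (auto simp: in_enlarge in_neg Y.E_\<beta>\<alpha>_iff E_\<beta>\<alpha>_iff \<beta>)
  next
    case False
    \<comment> \<open>\<open>\<beta>\<close> reverses the order of levels, which turns this into the duality of levels for
      \<open>\<alpha>\<close> alone.\<close>
    have "level_le (level_\<beta> (level_\<alpha> (snd u))) (level_\<beta> (snd v)) \<longleftrightarrow> \<not> level_le (snd u) (snd v)"
      using False uv level_le_4 by (simp add: level_le_\<beta> level_le_dual)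
    then show ?thesis
      using False uv by (auto simp: in_enlarge Y.E_\<beta>\<alpha>_iff) (auto simp: \<alpha>Y_def \<beta>Y_def)
  qed
qed (rule enlarge_subset_Y)

lemma zero_Y: "zero Y.D = enlarge (zero D)"
  by (simp add: zero_eq_dash enlarge_dash Y.zero_eq_dash)

definition nested_embedding :: "('a \<Rightarrow> 'x rel) \<Rightarrow> int + 'a \<Rightarrow> ('x \<times> nat) rel" where
  "nested_embedding h m = (case m of Inl k \<Rightarrow> if k < 0 then {} else EY | Inr l \<Rightarrow> enlarge (h l))"

lemma nested_embedding_simps [simp]:
  "nested_embedding h (Inl k) = (if k < 0 then {} else EY)"
  "nested_embedding h (Inr l) = enlarge (h l)"
  by (simp_all add: nested_embedding_def)

lemma nested_embedding_is_embedding: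
  assumes L: "dqra L" and h: "qra_embedding L D h"
  shows "qra_embedding (nested_sum S3 L) Y.D (nested_embedding h)"
proof -
  interpret L: dqra L by fact
  let ?N = "nested_sum S3 L" and ?g = "nested_embedding h"
  have h_Up: "h l \<in> Up leX E" if "l \<in> carrier L" for l
    using h that by (auto simp: qra_embedding_def)
  then have h_E: "h l \<subseteq> E" if "l \<in> carrier L" for l
    using that by (auto simp: Up_def)
  have hom: "h \<one>\<^bsub>L\<^esub> = leX" "h (zero L) = zero D"
    "\<And>l. l \<in> carrier L \<Longrightarrow> h (tilde L l) = tilde D (h l)"
    "\<And>l. l \<in> carrier L \<Longrightarrow> h (dash L l) = dash D (h l)"
    "\<And>l. l \<in> carrier L \<Longrightarrow> h (neg L l) = neg D (h l)"
    "\<And>l l'. l \<in> carrier L \<Longrightarrow> l' \<in> carrier L \<Longrightarrow> h (wedge L l l') = h l \<inter> h l'"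
    "\<And>l l'. l \<in> carrier L \<Longrightarrow> l' \<in> carrier L \<Longrightarrow> h (vee L l l') = h l \<union> h l'"
    "\<And>l l'. l \<in> carrier L \<Longrightarrow> l' \<in> carrier L \<Longrightarrow> h (l \<otimes>\<^bsub>L\<^esub> l') = h l O h l'"
    using h by (auto simp: qra_embedding_def)
  have absorb: "enlarge R \<inter> EY = enlarge R" "EY \<inter> enlarge R = enlarge R"
    "enlarge R \<union> EY = EY" "EY \<union> enlarge R = EY" for R
    using enlarge_subset by blast+
  have inj: "inj_on h (carrier L)"
    using h by (simp add: qra_embedding_def)
  have "l = l'" if "l \<in> carrier L" "l' \<in> carrier L" "enlarge (h l) = enlarge (h l')" for l l'
    using that h_E enlarge_inj inj by (metis inj_onD)
  then have "inj_on ?g (carrier ?N)"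
    using enlarge_neq enlarge_neq[THEN not_sym] EY_nonempty EY_nonempty[THEN not_sym]
    unfolding inj_on_def by (auto simp: nested_sum_S3_carrier split: if_splits)
  moreover have "?g ` carrier ?N \<subseteq> carrier Y.D"
    using enlarge_in_Up h_Up by (auto simp: nested_sum_S3_carrier Y.empty_in_Up Y.E_in_Up)
  moreover have "?g \<one>\<^bsub>?N\<^esub> = \<one>\<^bsub>Y.D\<^esub>" "?g (zero ?N) = zero Y.D"
    by (simp_all add: hom zero_Y)
  moreover have "\<forall>m\<in>carrier ?N. ?g (tilde ?N m) = tilde Y.D (?g m) \<and> ?g (dash ?N m) = dash Y.D (?g m)
      \<and> ?g (neg ?N m) = neg Y.D (?g m)"
    by (intro ballI, unfold nested_sum_S3_carrier, elim disjE bexE)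
      (simp_all add: hom h_E enlarge_tilde enlarge_dash enlarge_neg
        Y.negations_E Y.negations_empty)
  moreover have "\<forall>m\<in>carrier ?N. \<forall>m'\<in>carrier ?N. ?g (wedge ?N m m') = wedge Y.D (?g m) (?g m')
      \<and> ?g (vee ?N m m') = vee Y.D (?g m) (?g m') \<and> ?g (m \<otimes>\<^bsub>?N\<^esub> m') = ?g m \<otimes>\<^bsub>Y.D\<^esub> ?g m'"
    by (intro ballI, unfold nested_sum_S3_carrier, elim disjE bexE)
      (simp_all add: hom h_E S3_mult absorb enlarge_Int enlarge_Un enlarge_comp
        EY_comp_enlarge enlarge_comp_EY EY_comp_EY)
  ultimately show ?thesis
    unfolding qra_embedding_def by (intro conjI) (assumption+)
qed

lemma finite_Y: "finite X \<Longrightarrow> finite J \<Longrightarrow> finite Y"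
  by (simp add: Y_def)

end

lemma nested_sum_S3_represented:
  fixes L :: "('a, 'b) qra_scheme" and X :: "'x set"
  assumes L: "dqra L" and rep: "represented_on X L"
  shows "\<exists>Z :: ('x \<times> nat) set. represented_on Z (nested_sum S3 L) \<and> (finite X \<longrightarrow> finite Z)"
proof -
  from rep obtain leX E \<alpha> \<beta> h
    where frame: "dq_frame X leX E \<alpha> \<beta>" and h: "qra_embedding L (Dq X leX E \<alpha> \<beta>) h"
    by (rule represented_on_embedding)
  interpret dq_frame X leX E \<alpha> \<beta> by fact
  define c where "c x = (SOME y. (x, y) \<in> E)" for x
  \<comment> \<open>The name \<open>undefined\<close> provides a block of new points even if \<open>X\<close> is empty.\<close>
  define J where "J = insert undefined (c ` X)"
  have c_E: "(x, c x) \<in> E" if "x \<in> X" for x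
    unfolding c_def using E_\<alpha>[OF that] by (rule someI)
  have c_cong: "c x = c y" if "(x, y) \<in> E" for x y
  proof -
    have "(x, z) \<in> E \<longleftrightarrow> (y, z) \<in> E" for z
      using that E_sym E_trans by blast
    then show ?thesis by (simp add: c_def)
  qed
  interpret enlarged_frame X leX E \<alpha> \<beta> c J
  proof
    show "(x, y) \<in> E \<longleftrightarrow> x \<in> X \<and> y \<in> X \<and> c x = c y" for x y
      using c_E[of x] c_E[of y] c_cong E_D E_sym E_trans by metis
  qed (auto simp: J_def)
  have "quasi_relation_algebra (nested_sum S3 L)"
    using dqra_nested_sum_S3[OF L] by (rule dqra.axioms(1))
  then have "represented_on Y (nested_sum S3 L)"
    using frame_Y nested_embedding_is_embedding[OF L h] by (rule represented_onI)
  moreover have "finite X \<longrightarrow> finite Y"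
    by (rule impI, rule finite_Y) (simp_all add: J_def)
  ultimately show ?thesis by blast
qed

theorem theorem4p1:
  fixes L :: "'a qra"
  shows "(representable TYPE('x) L \<longrightarrow>
            representable TYPE('x \<times> nat) (nested_sum S3 L)) \<and>
         (finitely_representable TYPE('x) L \<longrightarrow>
            finitely_representable TYPE('x \<times> nat) (nested_sum S3 L))"
  unfolding representable_def finitely_representable_def
  using dqra_nested_sum_S3 nested_sum_S3_represented by blast

end
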